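(* Let $H$ be a real Hilbert space, let $K\subset H$ be a non-empty closed convex set, and let $F\colon K\to H$ be bounded on $K$ and strongly pseudomonotone on $K$ with modulus $\gamma=\frac12$. Suppose that the variational inequality $\mathrm{VI}(K,F)$ is solvable and let $x^\ast$ be its solution. Let $p\in\left(0,\frac12\right]$, let $x_1\in K$ and let $x_{k+1}=\mathrm{Pr}_K(x_k-\lambda_kF(x_k))$ with $\lambda_k=\frac1{k^p}$ for all $k\ge1$. Then $\|x^\ast-x_k\|$ converges to $0$ with rate $O\left(k^{-\frac p2}\right)$.
   Context: $H$ carries the inner product $\langle\cdot,\cdot\rangle$ and the induced norm $\|\cdot\|$. $\mathrm{VI}(K,F)$ is the problem of finding $x^\ast\in K$ such that $\langle F(x^\ast),x-x^\ast\rangle\ge 0$ for all $x\in K$; such an $x^\ast$ is called a solution, and $\mathrm{VI}(K,F)$ is solvable if it has a solution (which is then unique under strong pseudomonotonicity). $F$ is strongly pseudomonotone on $K$ with modulus $\gamma>0$ if for all $x,y\in K$: $\langle F(y),x-y\rangle\ge 0$ implies $\langle F(x),x-y\rangle\ge\gamma\|x-y\|^2$. $F$ is bounded on $K$ if there is $M>0$ with $\|F(x)\|\le M$ for all $x\in K$. $\mathrm{Pr}_K(x)$ denotes the metric projection of $x\in H$ onto $K$, i.e. the unique point of $K$ nearest to $x$. A real sequence $\{a_k\}$ converges to $0$ with rate $O(b_k)$, where $b_k\to0$, if there is a constant $C>0$ such that $|a_k|\le C|b_k|$ for all sufficiently large $k$. *)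

theory Defs
  imports "HOL-Analysis.Analysis" "HOL-Library.Landau_Symbols"
begin

text \<open>
  A real Hilbert space is a type of sort \<open>{real_inner, complete_space}\<close>. A map from \<open>K\<close> to the
  space is a total function of which only the values on \<open>K\<close> are constrained.
\<close>

definition vi_solution :: "'a::real_inner set \<Rightarrow> ('a \<Rightarrow> 'a) \<Rightarrow> 'a \<Rightarrow> bool" where
  "vi_solution K F xs \<longleftrightarrow> xs \<in> K \<and> (\<forall>x\<in>K. inner (F xs) (x - xs) \<ge> 0)"

definition strongly_pseudomonotone_on ::
  "'a::real_inner set \<Rightarrow> ('a \<Rightarrow> 'a) \<Rightarrow> real \<Rightarrow> bool" where
  "strongly_pseudomonotone_on K F \<gamma> \<longleftrightarrow> \<gamma> > 0 \<and>
     (\<forall>x\<in>K. \<forall>y\<in>K. inner (F y) (x - y) \<ge> 0 \<longrightarrow> inner (F x) (x - y) \<ge> \<gamma> * (norm (x - y))\<^sup>2)"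

definition norm_bounded_on :: "'a set \<Rightarrow> ('a \<Rightarrow> 'b::real_normed_vector) \<Rightarrow> bool" where
  "norm_bounded_on K F \<longleftrightarrow> (\<exists>M>0. \<forall>x\<in>K. norm (F x) \<le> M)"

text \<open>
  The library's \<^const>\<open>closest_point\<close> requires the sort \<open>heine_borel\<close>, hence finite dimension,
  and so cannot be used in a general Hilbert space. The description below denotes the nearest
  point whenever that point exists and is unique, which is the case for nonempty closed convex
  \<open>K\<close> in a Hilbert space.
\<close>

definition metric_proj :: "'a::metric_space set \<Rightarrow> 'a \<Rightarrow> 'a" where
  "metric_proj K x = (THE y. y \<in> K \<and> (\<forall>z\<in>K. dist x y \<le> dist x z))"

definition converges_to_0_with_rate :: "(nat \<Rightarrow> real) \<Rightarrow> (nat \<Rightarrow> real) \<Rightarrow> bool" where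
  "converges_to_0_with_rate a b \<longleftrightarrow>
     a \<longlonglongrightarrow> 0 \<and> b \<longlonglongrightarrow> 0 \<and> a \<in> bigo sequentially b"

end

theory Submission
  imports Defs
begin

text \<open>
  Strong pseudomonotonicity and nonexpansiveness of the projection give
  \<open>a\<^sub>k\<^sub>+\<^sub>1 \<le> (1 - k\<^sup>-\<^sup>p) a\<^sub>k + M\<^sup>2 k\<^sup>-\<^sup>2\<^sup>p\<close> for the squared errors \<open>a\<^sub>k\<close>,
  where \<open>M\<close> bounds \<open>F\<close>. The bound \<open>a\<^sub>k \<le> C k\<^sup>-\<^sup>p\<close>
  with \<open>C \<ge> 2M\<^sup>2\<close> is inductive, because \<open>p \<le> 1/2\<close> makes the decrement \<open>k\<^sup>-\<^sup>p - (k+1)\<^sup>-\<^sup>p\<close> at most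
  \<open>k\<^sup>-\<^sup>2\<^sup>p / 2\<close>.
\<close>

lemma power2_norm_diff_scaleR:
  fixes u v :: "'a::real_inner"
  shows "(norm (u - t *\<^sub>R v))\<^sup>2 = (norm u)\<^sup>2 - t * (2 * inner u v - t * (norm v)\<^sup>2)"
  by (simp add: power2_norm_eq_inner inner_diff_left inner_diff_right inner_commute[of v u]
      right_diff_distrib mult.assoc)

lemma parallelogram_identity:
  fixes u v :: "'a::real_inner"
  shows "(norm (u - v))\<^sup>2 + (norm (u + v))\<^sup>2 = 2 * (norm u)\<^sup>2 + 2 * (norm v)\<^sup>2"
  by (simp add: power2_norm_eq_inner inner_add_left inner_add_right inner_diff_left inner_diff_right)

text \<open>Parallelogram law for \<open>x - y\<close> and \<open>x - z\<close>, whose sum is twice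
  the vector from the midpoint to \<open>x\<close>. If \<open>d\<close> is the distance from
  \<open>x\<close> to a convex set containing \<open>y\<close> and \<open>z\<close>, two
  near-minimizers must be close; both existence and uniqueness of the projection rest on
  this.\<close>

lemma norm_diff_le_of_midpoint:
  fixes x y z :: "'a::real_inner"
  assumes "0 \<le> d" and "d \<le> norm (x - (1/2) *\<^sub>R (y + z))"
  shows "(norm (y - z))\<^sup>2 \<le> 2 * (norm (x - y))\<^sup>2 + 2 * (norm (x - z))\<^sup>2 - 4 * d\<^sup>2"
proof -
  have "(x - y) + (x - z) = 2 *\<^sub>R (x - (1/2) *\<^sub>R (y + z))"
    by (simp add: scaleR_right_diff_distrib scaleR_2)
  then have "norm ((x - y) + (x - z)) = 2 * norm (x - (1/2) *\<^sub>R (y + z))" by simp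
  then have "(2 * d)\<^sup>2 \<le> (norm ((x - y) + (x - z)))\<^sup>2"
    using assms by (intro power_mono) simp_all
  then show ?thesis
    using parallelogram_identity[of "x - y" "x - z"]
    by (simp add: norm_minus_commute power_mult_distrib)
qed

lemma midpoint_in_convex:
  fixes y z :: "'a::real_vector"
  assumes "convex K" "y \<in> K" "z \<in> K"
  shows "(1/2) *\<^sub>R (y + z) \<in> K"
  using convexD[OF assms, of "1/2" "1/2"] by (simp add: scaleR_add_right)

text \<open>A minimizing sequence is Cauchy by the midpoint inequality; completeness gives a limit,
  closedness keeps it in \<open>K\<close>, and continuity of the distance makes it attain the
  infimum.\<close>

lemma exists_closest_point:
  fixes K :: "'a::{real_inner, complete_space} set"
  assumes "K \<noteq> {}" "closed K" "convex K"
  shows "\<exists>y\<in>K. \<forall>z\<in>K. dist x y \<le> dist x z"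
proof -
  define d where "d = infdist x K"
  have d0: "0 \<le> d" by (simp add: d_def infdist_nonneg)
  have dle: "d \<le> dist x z" if "z \<in> K" for z
    using that by (simp add: d_def infdist_le)
  have "\<exists>y\<in>K. dist x y < d + 1 / real (Suc n)" for n
  proof (rule ccontr)
    assume "\<not> ?thesis"
    then have "d + 1 / real (Suc n) \<le> infdist x K"
      using assms(1) unfolding infdist_notempty[OF assms(1)]
      by (intro cINF_greatest) (auto simp: not_less)
    then show False by (simp add: d_def)
  qed
  then obtain y where yK: "\<And>n. y n \<in> K" and yd: "\<And>n. dist x (y n) < d + 1 / real (Suc n)"
    by metis
  have "(\<lambda>n. d + 1 / real (Suc n)) \<longlonglongrightarrow> d + 0"
    by (intro tendsto_add tendsto_const LIMSEQ_Suc lim_1_over_n)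
  then have upper: "(\<lambda>n. d + 1 / real (Suc n)) \<longlonglongrightarrow> d" by simp
  have lim: "(\<lambda>n. dist x (y n)) \<longlonglongrightarrow> d"
    by (rule real_tendsto_sandwich[OF _ _ tendsto_const upper])
      (intro always_eventually allI dle yK less_imp_le[OF yd])+
  from lim have sq: "(\<lambda>n. (dist x (y n))\<^sup>2) \<longlonglongrightarrow> d\<^sup>2" by (rule tendsto_power)
  have "Cauchy y"
  proof (rule metric_CauchyI)
    fix e :: real assume "0 < e"
    \<comment> \<open>The quarter is chosen so that in the midpoint inequality the two excesses add
      up to \<open>2 * (e^2/4 + e^2/4) = e^2\<close>, while the \<open>d^2\<close> terms
      cancel.\<close>
    then have "\<forall>\<^sub>F n in sequentially. (dist x (y n))\<^sup>2 < d\<^sup>2 + e\<^sup>2 / 4"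
      by (intro order_tendstoD(2)[OF sq]) simp
    then obtain N where N: "\<And>n. n \<ge> N \<Longrightarrow> (dist x (y n))\<^sup>2 < d\<^sup>2 + e\<^sup>2 / 4"
      by (auto simp: eventually_sequentially)
    have "dist (y m) (y n) < e" if "m \<ge> N" "n \<ge> N" for m n
    proof -
      have "(dist (y m) (y n))\<^sup>2 \<le> 2 * (dist x (y m))\<^sup>2 + 2 * (dist x (y n))\<^sup>2 - 4 * d\<^sup>2"
        using norm_diff_le_of_midpoint[OF d0, of x "y m" "y n"]
          dle[OF midpoint_in_convex[OF assms(3) yK yK]]
        by (simp add: dist_norm)
      also have "\<dots> < e\<^sup>2" using N[OF that(1)] N[OF that(2)] by linarith
      finally show ?thesis using \<open>0 < e\<close> by (auto intro: power2_less_imp_less)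
    qed
    then show "\<exists>N. \<forall>m\<ge>N. \<forall>n\<ge>N. dist (y m) (y n) < e" by blast
  qed
  then obtain l where l: "y \<longlonglongrightarrow> l"
    by (auto simp: Cauchy_convergent_iff convergent_def)
  have "l \<in> K" using closed_sequentially[OF assms(2) _ l] yK by blast
  moreover have "dist x l = d"
    by (rule LIMSEQ_unique[OF tendsto_dist[OF tendsto_const l] lim])
  ultimately show ?thesis using dle by auto
qed

lemma closest_points_unique:
  fixes K :: "'a::real_inner set"
  assumes "convex K"
    and "y \<in> K" "\<And>w. w \<in> K \<Longrightarrow> dist x y \<le> dist x w"
    and "z \<in> K" "\<And>w. w \<in> K \<Longrightarrow> dist x z \<le> dist x w"
  shows "y = z"
proof -
  have "dist x y = dist x z" using assms by (intro antisym) auto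
  moreover have "dist x y \<le> norm (x - (1/2) *\<^sub>R (y + z))"
    using assms(3)[OF midpoint_in_convex[OF assms(1,2,4)]] by (simp add: dist_norm)
  ultimately have "(norm (y - z))\<^sup>2 \<le> 0"
    using norm_diff_le_of_midpoint[of "dist x y" x y z] by (simp add: dist_norm)
  then show ?thesis by simp
qed

lemma metric_proj:
  fixes K :: "'a::{real_inner, complete_space} set"
  assumes "K \<noteq> {}" "closed K" "convex K"
  shows metric_proj_in: "metric_proj K x \<in> K"
    and metric_proj_le: "z \<in> K \<Longrightarrow> dist x (metric_proj K x) \<le> dist x z"
proof -
  have "\<exists>!y. y \<in> K \<and> (\<forall>z\<in>K. dist x y \<le> dist x z)"
    using exists_closest_point[OF assms, of x] closest_points_unique[OF assms(3)] by blast
  from theI'[OF this] show "metric_proj K x \<in> K"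
    and "z \<in> K \<Longrightarrow> dist x (metric_proj K x) \<le> dist x z"
    by (auto simp: metric_proj_def)
qed

text \<open>First-order optimality: if the inner product were positive, a small move from
  \<open>y\<close> towards \<open>z\<close> would stay in \<open>K\<close> and come closer to
  \<open>x\<close>.\<close>

lemma closest_point_obtuse:
  fixes K :: "'a::real_inner set"
  assumes "convex K" "y \<in> K" "z \<in> K" and le: "\<And>w. w \<in> K \<Longrightarrow> dist x y \<le> dist x w"
  shows "inner (x - y) (z - y) \<le> 0"
proof (rule ccontr)
  define c where "c = inner (x - y) (z - y)"
  define q where "q = (norm (z - y))\<^sup>2"
  assume "\<not> ?thesis"
  then have c: "0 < c" by (simp add: c_def)
  then have q: "0 < q" by (auto simp: q_def c_def)
  \<comment> \<open>The cap 1 keeps the moved point on the segment; the cap \<open>c / q\<close>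
    gives \<open>2 * c - t * q \<ge> c > 0\<close>, so the squared distance strictly drops.\<close>
  define t where "t = min 1 (c / q)"
  have t: "0 < t" "t \<le> 1" "t * q \<le> c"
    using c q by (auto simp: t_def min_def field_simps)
  have "(1 - t) *\<^sub>R y + t *\<^sub>R z \<in> K"
    using convexD[OF assms(1-3), of "1 - t" t] t by simp
  from le[OF this] have "(norm (x - y))\<^sup>2 \<le> (norm ((x - y) - t *\<^sub>R (z - y)))\<^sup>2"
    by (intro power_mono) (simp_all add: dist_norm algebra_simps)
  also have "\<dots> = (norm (x - y))\<^sup>2 - t * (2 * c - t * q)"
    unfolding c_def q_def by (rule power2_norm_diff_scaleR)
  finally have "t * (2 * c - t * q) \<le> 0" by linarith
  moreover have "0 < t * (2 * c - t * q)" using t c by (intro mult_pos_pos) linarith+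
  ultimately show False by linarith
qed

text \<open>Nonexpansiveness against a point \<open>z\<close> of \<open>K\<close>, which is its own
  projection. Expanding the square of \<open>x - z\<close> around the projection, the obtuse angle
  makes the cross term nonnegative.\<close>

lemma norm_metric_proj_diff_le:
  fixes K :: "'a::{real_inner, complete_space} set"
  assumes "K \<noteq> {}" "closed K" "convex K" and "z \<in> K"
  shows "norm (metric_proj K x - z) \<le> norm (x - z)"
proof -
  define y where "y = metric_proj K x"
  have "inner (x - y) (z - y) \<le> 0"
    unfolding y_def
    using closest_point_obtuse[OF assms(3) metric_proj_in[OF assms(1-3)] assms(4)]
      metric_proj_le[OF assms(1-3)] by blast
  moreover have "(norm (x - z))\<^sup>2 =
      (norm (x - y))\<^sup>2 - 2 * inner (x - y) (z - y) + (norm (y - z))\<^sup>2"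
    using power2_norm_diff_scaleR[of "x - y" 1 "z - y"] by (simp add: norm_minus_commute)
  moreover have "0 \<le> (norm (x - y))\<^sup>2" by simp
  ultimately have "(norm (y - z))\<^sup>2 \<le> (norm (x - z))\<^sup>2" by linarith
  then show ?thesis unfolding y_def by (rule power2_le_imp_le) simp
qed

lemma projection_step_bound:
  fixes K :: "'a::{real_inner, complete_space} set"
  assumes K: "K \<noteq> {}" "closed K" "convex K"
    and spm: "strongly_pseudomonotone_on K F \<gamma>" and sol: "vi_solution K F s"
    and "u \<in> K" and M: "norm (F u) \<le> M" and "0 \<le> r"
  shows "(norm (metric_proj K (u - r *\<^sub>R F u) - s))\<^sup>2
    \<le> (1 - 2 * \<gamma> * r) * (norm (u - s))\<^sup>2 + M\<^sup>2 * r\<^sup>2"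
proof -
  \<comment> \<open>The variational inequality at \<open>s\<close> is exactly the premise of strong
    pseudomonotonicity, which then bounds the cross term of the expanded square from below.\<close>
  have s: "s \<in> K" and "0 \<le> inner (F s) (u - s)"
    using sol \<open>u \<in> K\<close> by (auto simp: vi_solution_def)
  then have F: "\<gamma> * (norm (u - s))\<^sup>2 \<le> inner (F u) (u - s)"
    using spm \<open>u \<in> K\<close> by (auto simp: strongly_pseudomonotone_on_def)
  have "(norm (metric_proj K (u - r *\<^sub>R F u) - s))\<^sup>2 \<le> (norm (u - r *\<^sub>R F u - s))\<^sup>2"
    by (intro power_mono norm_metric_proj_diff_le K s norm_ge_zero)
  also have "u - r *\<^sub>R F u - s = (u - s) - r *\<^sub>R F u" by simp
  also have "(norm \<dots>)\<^sup>2 = (norm (u - s))\<^sup>2 - 2 * (r * inner (F u) (u - s)) + r\<^sup>2 * (norm (F u))\<^sup>2"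
    using power2_norm_diff_scaleR[of "u - s" r "F u"]
    by (simp add: inner_commute right_diff_distrib power2_eq_square)
  also have "\<dots> \<le> (norm (u - s))\<^sup>2 - 2 * (r * (\<gamma> * (norm (u - s))\<^sup>2)) + r\<^sup>2 * M\<^sup>2"
    using mult_left_mono[OF F \<open>0 \<le> r\<close>] mult_left_mono[OF power_mono[OF M norm_ge_zero, of 2], of "r\<^sup>2"]
    by simp
  finally show ?thesis by (simp add: algebra_simps)
qed

lemma powr_minus_decrement_le:
  fixes k p :: real
  assumes "1 \<le> k" "0 < p" "p \<le> 1/2"
  shows "k powr (-p) - (k + 1) powr (-p) \<le> (k powr (-p))\<^sup>2 / 2"
proof -
  \<comment> \<open>\<open>q\<close> is the ratio of consecutive indices, so the decrement is
    \<open>k powr (-p) * (1 - q powr p)\<close>; as \<open>q \<le> 1\<close> and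
    \<open>p \<le> 1\<close>, replacing \<open>q powr p\<close> by \<open>q\<close> can only enlarge
    it.\<close>
  define q where "q = k / (k + 1)"
  have q: "0 < q" "q \<le> 1" using assms by (auto simp: q_def)
  have "q powr 1 \<le> q powr p" using q assms by (intro powr_mono') auto
  then have "q \<le> q powr p" using q by simp
  moreover have "k powr (-p) * q powr p = (k + 1) powr (-p)"
    using assms by (simp add: q_def powr_divide powr_minus field_simps)
  ultimately have "k powr (-p) - (k + 1) powr (-p) \<le> k powr (-p) * (1 - q)"
    using mult_left_mono[of q "q powr p" "k powr (-p)"] by (simp add: algebra_simps)
  also have "1 - q \<le> k powr (-p) / 2"
  proof -
    \<comment> \<open>AM-GM, from \<open>(sqrt k - 1)^2 \<ge> 0\<close>. It bounds
      \<open>1 - q = 1 / (k + 1)\<close> by half of \<open>k powr (-1/2)\<close>, and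
      \<open>p \<le> 1/2\<close> with \<open>k \<ge> 1\<close> passes to the exponent
      \<open>-p\<close>.\<close>
    have "2 * k powr (1/2) \<le> k + 1"
      using sum_power2_ge_zero[of "sqrt k - 1" 0] assms
      by (simp add: powr_half_sqrt power2_diff)
    then have "1 / (k + 1) \<le> 1 / (2 * k powr (1/2))"
      using assms by (intro divide_left_mono) auto
    also have "\<dots> = k powr (- (1/2)) / 2"
      using assms by (simp only: powr_minus) (simp add: field_simps)
    also have "\<dots> \<le> k powr (-p) / 2"
      using assms by (intro divide_right_mono powr_mono) auto
    finally show ?thesis using assms by (simp add: q_def field_simps)
  qed
  finally show ?thesis by (simp add: power2_eq_square mult_left_mono)
qed

lemma recursion_rate:
  fixes a :: "nat \<Rightarrow> real" and p B C :: real
  assumes p: "0 < p" "p \<le> 1/2"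
    and step: "\<And>k. k \<ge> 1 \<Longrightarrow>
      a (k + 1) \<le> (1 - real k powr (-p)) * a k + B * (real k powr (-p))\<^sup>2"
    and C: "a 1 \<le> C" "0 \<le> C" "2 * B \<le> C"
    and "k \<ge> 1"
  shows "a k \<le> C * real k powr (-p)"
  using \<open>k \<ge> 1\<close>
proof (induction k rule: dec_induct)
  case base
  show ?case using C by simp
next
  case (step k)
  define l where "l = real k powr (-p)"
  have k1: "1 \<le> real k" using step.hyps by simp
  \<comment> \<open>\<open>l \<le> 1\<close> keeps the factor \<open>1 - l\<close> nonnegative, so
    that the induction hypothesis may be multiplied by it.\<close>
  have l: "l \<le> 1" "0 \<le> l"
    using powr_mono[of "-p" 0 "real k"] k1 p by (auto simp: l_def)
  have dec: "l - real (k + 1) powr (-p) \<le> l\<^sup>2 / 2"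
    using powr_minus_decrement_le[OF k1 p] by (simp add: l_def add.commute)
  have "a (k + 1) \<le> (1 - l) * a k + B * l\<^sup>2" using assms(3)[of k] step.hyps by (simp add: l_def)
  also have "\<dots> \<le> (1 - l) * (C * l) + (C / 2) * l\<^sup>2"
    using step.IH l C(3) by (intro add_mono mult_left_mono mult_right_mono) (auto simp: l_def)
  \<comment> \<open>The contraction gains \<open>C * l^2\<close> and the error term returns at most
    half of it; what remains covers the decrement of \<open>k powr (-p)\<close>.\<close>
  also have "\<dots> = C * (l - l\<^sup>2 / 2)" by (simp add: algebra_simps power2_eq_square)
  also have "\<dots> \<le> C * real (k + 1) powr (-p)"
    using dec C by (intro mult_left_mono) auto
  finally show ?case by simp
qed

theorem theorem5p3:
  fixes K :: "'a::{real_inner, complete_space} set"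
    and F :: "'a \<Rightarrow> 'a"
    and xstar :: 'a
    and p :: real
    and x :: "nat \<Rightarrow> 'a"
    and lam :: "nat \<Rightarrow> real"
  assumes "K \<noteq> {}" and "closed K" and "convex K"
    and "norm_bounded_on K F"
    and "strongly_pseudomonotone_on K F (1/2)"
    and "vi_solution K F xstar"
    and "0 < p" and "p \<le> 1/2"
    and "\<And>k. k \<ge> 1 \<Longrightarrow> lam k = 1 / real k powr p"
    and "x 1 \<in> K"
    and "\<And>k. k \<ge> 1 \<Longrightarrow> x (k + 1) = metric_proj K (x k - lam k *\<^sub>R F (x k))"
  shows "converges_to_0_with_rate (\<lambda>k. norm (xstar - x k)) (\<lambda>k. real k powr (- p / 2))"
proof -
  obtain M where M: "\<And>u. u \<in> K \<Longrightarrow> norm (F u) \<le> M"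
    using assms(4) by (auto simp: norm_bounded_on_def)
  have xK: "x k \<in> K" if "k \<ge> 1" for k
    using that
  proof (induction k rule: dec_induct)
    case base
    show ?case by fact
  next
    case (step k)
    show ?case using assms(11)[of k] step.hyps metric_proj_in[OF assms(1-3)] by simp
  qed
  define a where "a k = (norm (x k - xstar))\<^sup>2" for k
  \<comment> \<open>The first entry starts the induction at index 1; the second lets the error term
    \<open>M^2\<close> use up at most half of the contraction.\<close>
  define C where "C = max (a 1) (2 * M\<^sup>2)"
  have C: "a 1 \<le> C" "0 \<le> C" "2 * M\<^sup>2 \<le> C"
    by (auto simp: C_def a_def le_max_iff_disj)
  have step: "a (k + 1) \<le> (1 - real k powr (-p)) * a k + M\<^sup>2 * (real k powr (-p))\<^sup>2"
    if "k \<ge> 1" for k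
  proof -
    have lam: "lam k = real k powr (-p)"
      using assms(9)[OF that] by (simp add: powr_minus field_simps)
    \<comment> \<open>With modulus 1/2 the contraction factor \<open>1 - 2 * \<gamma> * r\<close> is
      exactly \<open>1 - lam k\<close>.\<close>
    show ?thesis
      using projection_step_bound[OF assms(1-3,5,6) xK[OF that] M[OF xK[OF that]], of "lam k"]
      unfolding a_def assms(11)[OF that] lam by simp
  qed
  \<comment> \<open>Taking square roots in the bound for \<open>a k\<close> halves the
    exponent.\<close>
  have bound: "norm (xstar - x k) \<le> sqrt C * real k powr (-p / 2)" if "k \<ge> 1" for k
  proof (rule power2_le_imp_le)
    have "real k powr (-p) = (real k powr (-p / 2))\<^sup>2"
      by (simp add: power2_eq_square flip: powr_add)
    then show "(norm (xstar - x k))\<^sup>2 \<le> (sqrt C * real k powr (-p / 2))\<^sup>2"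
      using recursion_rate[where a = a, OF assms(7,8) step C that] C(2)
      by (simp add: a_def power_mult_distrib norm_minus_commute)
  qed (use C in simp)
  \<comment> \<open>The iteration starts at index 1 and \<open>x 0\<close> is arbitrary, so the
    bound is passed on as an eventual one.\<close>
  have ev: "\<forall>\<^sub>F k in sequentially. norm (xstar - x k) \<le> sqrt C * real k powr (-p / 2)"
    using eventually_ge_at_top[of 1] by eventually_elim (rule bound)
  have b0: "(\<lambda>k. real k powr (-p / 2)) \<longlonglongrightarrow> 0"
    using assms(7) by (intro tendsto_neg_powr filterlim_real_sequentially) simp
  then have "(\<lambda>k. sqrt C * real k powr (-p / 2)) \<longlonglongrightarrow> 0"
    by (rule tendsto_mult_right_zero)
  then have "(\<lambda>k. norm (xstar - x k)) \<longlonglongrightarrow> 0"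
    by (intro real_tendsto_sandwich[OF _ ev tendsto_const]) auto
  moreover have "(\<lambda>k. norm (xstar - x k)) \<in> O(\<lambda>k. real k powr (-p / 2))"
    using ev by (intro bigoI[of _ "sqrt C"]) simp
  ultimately show ?thesis using b0 by (simp add: converges_to_0_with_rate_def)
qed

end
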